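(* Let $n\in\mathbb{N}$ and $M\in\mathbb{R}^{(2n+1)\times(2n+1)}$. (a) $M\in A_{2n+1}^o$ if and only if $$M=\mathcal{X}_{2n+1}\begin{pmatrix}\mathcal{O}_n & 0_n & V^T\\ 0_n^T & 0 & -\sqrt2\,(V1_n)^T\\ W & -\sqrt2\,W1_n & \mathcal{O}_n\end{pmatrix}\mathcal{X}_{2n+1}$$ with matrices $V,W\in\mathbb{R}^{n\times n}$. Moreover, $M$ has rational entries if and only if $V$ and $W$ have rational entries. (b) $M\in B_{2n+1}^o$ if and only if $$M=\mathcal{X}_{2n+1}\begin{pmatrix}Y & -\sqrt2\,Y1_n & \mathcal{O}_n\\ -\sqrt2\,(Y^T1_n)^T & 2\cdot1_n^TY1_n & 0_n^T\\ \mathcal{O}_n & 0_n & Z\end{pmatrix}\mathcal{X}_{2n+1}$$ with matrices $Y,Z\in\mathbb{R}^{n\times n}$. Moreover, $M$ has rational entries if and only if $Y$ and $Z$ have rational entries. (c) The matrix $\mathcal{E}_{2n+1}$ satisfies $$\mathcal{E}_{2n+1}=\mathcal{X}_{2n+1}\begin{pmatrix}2\mathcal{E}_n & \sqrt2\,1_n & \mathcal{O}_n\\ \sqrt2\,1_n^T & 1 & 0_n^T\\ \mathcal{O}_n & 0_n & \mathcal{O}_n\end{pmatrix}\mathcal{X}_{2n+1}.$$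
   Context: An $m\times m$ real matrix $M$ is a semimagic square of weight $w\in\mathbb{R}$ if each of its rows and each of its columns sums to $mw$. A semimagic square $M$ of weight $w$ is associated if $M_{ij}+M_{m+1-i,m+1-j}=2w$ for all $i,j\in\{1,\dots,m\}$, and balanced if $M_{ij}=M_{m+1-i,m+1-j}$ for all $i,j$. $A_m^o$ and $B_m^o$ denote the sets of $m\times m$ associated, respectively balanced, semimagic square matrices of weight $0$. $1_m\in\mathbb{R}^m$ is the column vector with all entries $1$, $0_m\in\mathbb{R}^m$ the null vector, $\mathcal{E}_m$ the $m\times m$ matrix with all entries $1$, $\mathcal{O}_m$ the $m\times m$ null matrix, $\mathcal{I}_m$ the unit matrix, and $\mathcal{J}_m=(\delta_{i,m+1-j})_{i,j=1}^m$ the matrix with ones on the antidiagonal and zeros elsewhere. Furthermore $$\mathcal{X}_{2n+1}=\begin{pmatrix}\frac1{\sqrt2}\mathcal{I}_n & 0_n & \frac1{\sqrt2}\mathcal{J}_n\\ 0_n^T & 1 & 0_n^T\\ \frac1{\sqrt2}\mathcal{J}_n & 0_n & -\frac1{\sqrt2}\mathcal{I}_n\end{pmatrix}\in\mathbb{R}^{(2n+1)\times(2n+1)}.$$ *)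

theory Defs
  imports Complex_Main "Jordan_Normal_Form.Matrix"
begin

text \<open>
  Matrices are Jordan normal form matrices with dimensions given by natural numbers, so rows and
  columns are numbered from 0: the index \<open>m + 1 - i\<close> of the mathematical text is \<open>m - 1 - i\<close> here.
  Elements of R^m occurring as columns (rows) of block matrices are m x 1 (1 x m) matrices.
\<close>

definition semimagic :: "nat \<Rightarrow> real \<Rightarrow> real mat \<Rightarrow> bool" where
  "semimagic m w M \<longleftrightarrow> M \<in> carrier_mat m m \<and>
     (\<forall>i<m. (\<Sum>j<m. M $$ (i, j)) = real m * w) \<and>
     (\<forall>j<m. (\<Sum>i<m. M $$ (i, j)) = real m * w)"

definition associated :: "nat \<Rightarrow> real \<Rightarrow> real mat \<Rightarrow> bool" where
  "associated m w M \<longleftrightarrow> semimagic m w M \<and>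
     (\<forall>i<m. \<forall>j<m. M $$ (i, j) + M $$ (m - 1 - i, m - 1 - j) = 2 * w)"

definition balanced :: "nat \<Rightarrow> real \<Rightarrow> real mat \<Rightarrow> bool" where
  "balanced m w M \<longleftrightarrow> semimagic m w M \<and>
     (\<forall>i<m. \<forall>j<m. M $$ (i, j) = M $$ (m - 1 - i, m - 1 - j))"

definition A0 :: "nat \<Rightarrow> real mat set" where
  "A0 m = {M. associated m 0 M}"

definition B0 :: "nat \<Rightarrow> real mat set" where
  "B0 m = {M. balanced m 0 M}"

definition one_col :: "nat \<Rightarrow> real mat" where
  "one_col m = mat m 1 (\<lambda>_. 1)"

abbreviation zero_col :: "nat \<Rightarrow> real mat" where
  "zero_col m \<equiv> 0\<^sub>m m 1"

definition ones_mat :: "nat \<Rightarrow> real mat" where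
  "ones_mat m = mat m m (\<lambda>_. 1)"

definition J_mat :: "nat \<Rightarrow> real mat" where
  "J_mat m = mat m m (\<lambda>(i, j). if i = m - 1 - j then 1 else 0)"

definition append_cols :: "'a::zero mat \<Rightarrow> 'a mat \<Rightarrow> 'a mat" (infixr \<open>@\<^sub>c\<close> 66) where
  "A @\<^sub>c B = four_block_mat A B (0\<^sub>m 0 (dim_col A)) (0\<^sub>m 0 (dim_col B))"

text \<open>
  The parameter \<open>n\<close> is the block size: \<open>X_mat n\<close> is the matrix X with index 2n+1, and it and the three block
  matrices below have dimension 2n+1.
\<close>

definition X_mat :: "nat \<Rightarrow> real mat" where
  "X_mat n =
     ((1 / sqrt 2) \<cdot>\<^sub>m 1\<^sub>m n @\<^sub>c zero_col n     @\<^sub>c (1 / sqrt 2) \<cdot>\<^sub>m J_mat n) @\<^sub>r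
     ((zero_col n)\<^sup>T         @\<^sub>c 1\<^sub>m 1          @\<^sub>c (zero_col n)\<^sup>T) @\<^sub>r
     ((1 / sqrt 2) \<cdot>\<^sub>m J_mat n @\<^sub>c zero_col n @\<^sub>c (- 1 / sqrt 2) \<cdot>\<^sub>m 1\<^sub>m n)"

definition A_block :: "nat \<Rightarrow> real mat \<Rightarrow> real mat \<Rightarrow> real mat" where
  "A_block n V W =
     (0\<^sub>m n n @\<^sub>c zero_col n @\<^sub>c V\<^sup>T) @\<^sub>r
     ((zero_col n)\<^sup>T @\<^sub>c 0\<^sub>m 1 1 @\<^sub>c (- sqrt 2) \<cdot>\<^sub>m (V * one_col n)\<^sup>T) @\<^sub>r
     (W @\<^sub>c (- sqrt 2) \<cdot>\<^sub>m (W * one_col n) @\<^sub>c 0\<^sub>m n n)"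

definition B_block :: "nat \<Rightarrow> real mat \<Rightarrow> real mat \<Rightarrow> real mat" where
  "B_block n Y Z =
     (Y @\<^sub>c (- sqrt 2) \<cdot>\<^sub>m (Y * one_col n) @\<^sub>c 0\<^sub>m n n) @\<^sub>r
     ((- sqrt 2) \<cdot>\<^sub>m (Y\<^sup>T * one_col n)\<^sup>T @\<^sub>c 2 \<cdot>\<^sub>m ((one_col n)\<^sup>T * Y * one_col n) @\<^sub>c (zero_col n)\<^sup>T) @\<^sub>r
     (0\<^sub>m n n @\<^sub>c zero_col n @\<^sub>c Z)"

definition E_block :: "nat \<Rightarrow> real mat" where
  "E_block n =
     (2 \<cdot>\<^sub>m ones_mat n @\<^sub>c sqrt 2 \<cdot>\<^sub>m one_col n @\<^sub>c 0\<^sub>m n n) @\<^sub>r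
     (sqrt 2 \<cdot>\<^sub>m (one_col n)\<^sup>T @\<^sub>c 1\<^sub>m 1 @\<^sub>c (zero_col n)\<^sup>T) @\<^sub>r
     (0\<^sub>m n n @\<^sub>c zero_col n @\<^sub>c 0\<^sub>m n n)"

definition rational_entries :: "real mat \<Rightarrow> bool" where
  "rational_entries M \<longleftrightarrow> elements_mat M \<subseteq> \<rat>"

end

theory Submission
  imports Defs
begin

text \<open>
  The matrix X is symmetric and \<open>X X = 1\<close> (\<open>X_mat_involution\<close>), so \<open>M = X P X\<close> and \<open>P = X M X\<close> say the
  same (\<open>X_conjugate_twice\<close>), and each property of \<open>M\<close> becomes a property of \<open>P\<close> in coordinates
  adapted to the point reflection of the square.

  The first \<open>n + 1\<close> columns of X are symmetric vectors, the last \<open>n\<close> antisymmetric ones. The point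
  reflection of \<open>M\<close> therefore corresponds to a change of sign in the two off-diagonal blocks of \<open>P\<close>, for
  the partition of the indices into \<open>{0..n}\<close> and the rest. So \<open>M\<close> is odd under the reflection if
  and only if the diagonal blocks of \<open>P\<close> vanish (\<open>X_conjugate_skew_iff\<close>), and even if and only if the
  off-diagonal ones do (\<open>X_conjugate_even_iff\<close>).

  All row sums of \<open>M\<close> vanish if and only if \<open>P\<close> annihilates the image of the vector of ones under X, which
  is \<open>(sqrt 2, \<dots>, sqrt 2, 1, 0, \<dots>, 0)\<close>; the same holds for the columns by transposition
  (\<open>X_conjugate_semimagic_iff\<close>). This expresses the middle column and the middle row of \<open>P\<close> by the remaining
  entries. Together, the two conditions describe exactly the block matrices of the theorem
  (\<open>A_block_iff\<close>, \<open>B_block_iff\<close>).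

  For rationality, X is a matrix with entries in \<open>{-1, 0, 1}\<close> times the diagonal matrix with entry \<open>1\<close> in
  the middle and \<open>1 / sqrt 2\<close> elsewhere. Hence \<open>M\<close> is rational if and only if \<open>P\<close>, scaled by this
  diagonal matrix on both sides, is (\<open>X_conjugate_rational_iff\<close>), and in the scaled block matrices
  no square root is left.
\<close>

section \<open>Block matrices of size 2n+1\<close>

lemma blocks_carrier:
  assumes "A11 \<in> carrier_mat n n" "A12 \<in> carrier_mat n 1" "A13 \<in> carrier_mat n n"
    and "A21 \<in> carrier_mat 1 n" "A22 \<in> carrier_mat 1 1" "A23 \<in> carrier_mat 1 n"
    and "A31 \<in> carrier_mat n n" "A32 \<in> carrier_mat n 1" "A33 \<in> carrier_mat n n"
  shows "(A11 @\<^sub>c A12 @\<^sub>c A13) @\<^sub>r (A21 @\<^sub>c A22 @\<^sub>c A23) @\<^sub>r (A31 @\<^sub>c A32 @\<^sub>c A33)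
      \<in> carrier_mat (2 * n + 1) (2 * n + 1)"
  using assms by (auto simp: append_rows_def append_cols_def)

lemma blocks_index:
  assumes "A11 \<in> carrier_mat n n" "A12 \<in> carrier_mat n 1" "A13 \<in> carrier_mat n n"
    and "A21 \<in> carrier_mat 1 n" "A22 \<in> carrier_mat 1 1" "A23 \<in> carrier_mat 1 n"
    and "A31 \<in> carrier_mat n n" "A32 \<in> carrier_mat n 1" "A33 \<in> carrier_mat n n"
    and "i < 2 * n + 1" "j < 2 * n + 1"
  shows "((A11 @\<^sub>c A12 @\<^sub>c A13) @\<^sub>r (A21 @\<^sub>c A22 @\<^sub>c A23) @\<^sub>r (A31 @\<^sub>c A32 @\<^sub>c A33)) $$ (i, j) =
    (if i < n then
       if j < n then A11 $$ (i, j) else if j = n then A12 $$ (i, 0) else A13 $$ (i, j - Suc n)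
     else if i = n then
       if j < n then A21 $$ (0, j) else if j = n then A22 $$ (0, 0) else A23 $$ (0, j - Suc n)
     else
       if j < n then A31 $$ (i - Suc n, j) else if j = n then A32 $$ (i - Suc n, 0)
       else A33 $$ (i - Suc n, j - Suc n))"
  using assms by (auto simp: append_rows_def append_cols_def)

lemma X_mat_carrier: "X_mat n \<in> carrier_mat (2 * n + 1) (2 * n + 1)"
  unfolding X_mat_def by (rule blocks_carrier) (auto simp: J_mat_def)

lemma X_mat_dim [simp]: "dim_row (X_mat n) = 2 * n + 1" "dim_col (X_mat n) = 2 * n + 1"
  using X_mat_carrier[of n] by (rule carrier_matD)+

section \<open>The matrix X\<close>

lemma J_mat_index:
  assumes "a < n" "b < n"
  shows "J_mat n $$ (a, b) = (if a + b + 1 = n then 1 else 0)"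
  using assms by (auto simp: J_mat_def)

lemma X_mat_index:
  assumes "i < 2 * n + 1" "j < 2 * n + 1"
  shows "X_mat n $$ (i, j) =
    (if i = j then if i < n then 1 / sqrt 2 else if i = n then 1 else - 1 / sqrt 2
     else if i + j = 2 * n then 1 / sqrt 2 else 0)"
proof -
  have J: "J_mat n \<in> carrier_mat n n" by (simp add: J_mat_def)
  have blocks: "X_mat n $$ (i, j) =
    (if i < n then
       if j < n then ((1 / sqrt 2) \<cdot>\<^sub>m 1\<^sub>m n) $$ (i, j) else if j = n then zero_col n $$ (i, 0)
       else ((1 / sqrt 2) \<cdot>\<^sub>m J_mat n) $$ (i, j - Suc n)
     else if i = n then
       if j < n then (zero_col n)\<^sup>T $$ (0, j) else if j = n then 1\<^sub>m 1 $$ (0, 0)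
       else (zero_col n)\<^sup>T $$ (0, j - Suc n)
     else
       if j < n then ((1 / sqrt 2) \<cdot>\<^sub>m J_mat n) $$ (i - Suc n, j)
       else if j = n then zero_col n $$ (i - Suc n, 0)
       else ((- 1 / sqrt 2) \<cdot>\<^sub>m 1\<^sub>m n) $$ (i - Suc n, j - Suc n))"
    unfolding X_mat_def
    by (rule blocks_index[OF _ _ _ _ _ _ _ _ _ assms]) (use J in simp_all)
  have dims: "dim_row (J_mat n) = n" "dim_col (J_mat n) = n" using J by auto
  show ?thesis
  proof (cases i n rule: linorder_cases)
    case less
    then show ?thesis unfolding blocks using assms
      by (cases j n rule: linorder_cases) (simp_all add: J_mat_index dims, arith?)
  next
    case equal
    then show ?thesis unfolding blocks using assms
      by (cases j n rule: linorder_cases) simp_all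
  next
    case greater
    then show ?thesis unfolding blocks using assms
      by (cases j n rule: linorder_cases) (simp_all add: J_mat_index dims, arith+)
  qed
qed

text \<open>
  Each row of X has at most two nonzero entries, in the columns \<open>i\<close> and \<open>2 n - i\<close>; these columns
  coincide exactly in the middle row.
\<close>

lemma X_mat_sum:
  assumes "i < 2 * n + 1"
  shows "(\<Sum>k<2 * n + 1. X_mat n $$ (i, k) * f k) =
    (if i < n then (f i + f (2 * n - i)) / sqrt 2
     else if i = n then f n else (f (2 * n - i) - f i) / sqrt 2)"
proof -
  have "(\<Sum>k<2 * n + 1. X_mat n $$ (i, k) * f k) = (\<Sum>k\<in>{i, 2 * n - i}. X_mat n $$ (i, k) * f k)"
    using assms by (intro sum.mono_neutral_right) (auto simp: X_mat_index)
  also have "\<dots> = (if i = n then X_mat n $$ (n, n) * f n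
      else X_mat n $$ (i, i) * f i + X_mat n $$ (i, 2 * n - i) * f (2 * n - i))"
    using assms by (auto simp: numeral_2_eq_2)
  also have "\<dots> = (if i < n then (f i + f (2 * n - i)) / sqrt 2
     else if i = n then f n else (f (2 * n - i) - f i) / sqrt 2)"
    using assms by (auto simp: X_mat_index add_divide_distrib diff_divide_distrib)
  finally show ?thesis .
qed

lemma X_mat_symmetric: "(X_mat n)\<^sup>T = X_mat n"
proof (rule eq_matI)
  fix i j assume "i < dim_row (X_mat n)" "j < dim_col (X_mat n)"
  then have ij: "i < 2 * n + 1" "j < 2 * n + 1" by simp_all
  have "X_mat n $$ (j, i) = X_mat n $$ (i, j)"
    unfolding X_mat_index[OF ij] X_mat_index[OF ij(2) ij(1)]
    by (cases "i = j") (simp_all add: add.commute)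
  then show "(X_mat n)\<^sup>T $$ (i, j) = X_mat n $$ (i, j)" using ij by simp
qed simp_all

lemma index_mult_sum:
  assumes "A \<in> carrier_mat r s" "B \<in> carrier_mat s t" "i < r" "j < t"
  shows "(A * B) $$ (i, j) = (\<Sum>k<s. A $$ (i, k) * B $$ (k, j))"
  using assms by (auto simp: scalar_prod_def atLeast0LessThan)

lemma X_mat_involution: "X_mat n * X_mat n = 1\<^sub>m (2 * n + 1)"
proof (rule eq_matI)
  fix i j assume "i < dim_row (1\<^sub>m (2 * n + 1))" "j < dim_col (1\<^sub>m (2 * n + 1))"
  then have ij: "i < 2 * n + 1" "j < 2 * n + 1" by auto
  have "(X_mat n * X_mat n) $$ (i, j) = (\<Sum>k<2 * n + 1. X_mat n $$ (i, k) * X_mat n $$ (k, j))"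
    by (rule index_mult_sum[OF X_mat_carrier X_mat_carrier ij])
  also have "\<dots> = 1\<^sub>m (2 * n + 1) $$ (i, j)"
  proof (cases i n rule: linorder_cases)
    case less
    then have "X_mat n $$ (2 * n - i, j) = (if j = i then 1 / sqrt 2 else if j = 2 * n - i then - 1 / sqrt 2 else 0)"
      "X_mat n $$ (i, j) = (if j = i then 1 / sqrt 2 else if j = 2 * n - i then 1 / sqrt 2 else 0)"
      using ij by (simp_all add: X_mat_index) arith+
    with less ij show ?thesis unfolding X_mat_sum[OF ij(1)] by simp
  next
    case equal
    with ij show ?thesis unfolding X_mat_sum[OF ij(1)] by (simp add: X_mat_index)
  next
    case greater
    then have "X_mat n $$ (2 * n - i, j) = (if j = i then 1 / sqrt 2 else if j = 2 * n - i then 1 / sqrt 2 else 0)"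
      "X_mat n $$ (i, j) = (if j = i then - 1 / sqrt 2 else if j = 2 * n - i then 1 / sqrt 2 else 0)"
      using ij by (simp_all add: X_mat_index) arith+
    with greater ij show ?thesis unfolding X_mat_sum[OF ij(1)] by simp
  qed
  finally show "(X_mat n * X_mat n) $$ (i, j) = 1\<^sub>m (2 * n + 1) $$ (i, j)" .
qed auto

section \<open>Conjugation by X\<close>

lemma X_mat_cancel:
  assumes "P \<in> carrier_mat (2 * n + 1) m"
  shows "X_mat n * (X_mat n * P) = P"
proof -
  have "X_mat n * (X_mat n * P) = (X_mat n * X_mat n) * P"
    by (rule assoc_mult_mat[symmetric, OF X_mat_carrier X_mat_carrier assms])
  then show ?thesis using assms by (simp add: X_mat_involution)
qed

text \<open>
  As X is its own inverse, every square matrix \<open>M\<close> of this size is \<open>X P X\<close> for exactly one \<open>P\<close>, namely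
  \<open>P = X M X\<close>. Properties of \<open>M\<close> can therefore be read off as properties of \<open>P\<close>.
\<close>

lemma X_conjugate_twice:
  assumes P: "P \<in> carrier_mat (2 * n + 1) (2 * n + 1)"
  shows "X_mat n * (X_mat n * P * X_mat n) * X_mat n = P"
proof -
  note X = X_mat_carrier[of n]
  have "X_mat n * (X_mat n * P * X_mat n) * X_mat n
      = X_mat n * (X_mat n * (P * (X_mat n * X_mat n)))"
    using assoc_mult_mat[OF X mult_carrier_mat[OF mult_carrier_mat[OF X P] X] X]
      assoc_mult_mat[OF mult_carrier_mat[OF X P] X X]
      assoc_mult_mat[OF X P mult_carrier_mat[OF X X]] by metis
  then show ?thesis using X_mat_cancel[OF P] P by (simp add: X_mat_involution)
qed

lemma X_conjugate_eq_iff: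
  assumes "P \<in> carrier_mat (2 * n + 1) (2 * n + 1)" "Q \<in> carrier_mat (2 * n + 1) (2 * n + 1)"
  shows "X_mat n * P * X_mat n = X_mat n * Q * X_mat n \<longleftrightarrow> P = Q"
    (is "?P = ?Q \<longleftrightarrow> _")
proof
  assume "?P = ?Q"
  then have "X_mat n * ?P * X_mat n = X_mat n * ?Q * X_mat n" by (rule arg_cong)
  then show "P = Q"
    unfolding X_conjugate_twice[OF assms(1)] X_conjugate_twice[OF assms(2)] .
next
  assume "P = Q"
  then show "?P = ?Q" by (rule arg_cong)
qed

lemma X_conjugate_carrier:
  assumes "P \<in> carrier_mat (2 * n + 1) (2 * n + 1)"
  shows "X_mat n * P * X_mat n \<in> carrier_mat (2 * n + 1) (2 * n + 1)"
  by (intro mult_carrier_mat[OF _ X_mat_carrier] mult_carrier_mat[OF X_mat_carrier] assms)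

lemma X_conjugate_index:
  assumes P: "P \<in> carrier_mat (2 * n + 1) (2 * n + 1)" and ij: "i < 2 * n + 1" "j < 2 * n + 1"
  shows "(X_mat n * P * X_mat n) $$ (i, j) =
    (\<Sum>l<2 * n + 1. \<Sum>k<2 * n + 1. X_mat n $$ (i, k) * P $$ (k, l) * X_mat n $$ (l, j))"
proof -
  note X = X_mat_carrier[of n]
  have XP: "X_mat n * P \<in> carrier_mat (2 * n + 1) (2 * n + 1)" using X P by (rule mult_carrier_mat)
  show ?thesis
    unfolding index_mult_sum[OF XP X ij] sum_distrib_right[symmetric]
    by (intro sum.cong refl arg_cong2[where f = "(*)"] index_mult_sum[OF X P]) (use ij in auto)
qed

section \<open>Point reflections and the parity of blocks\<close>

text \<open>
  Column \<open>k\<close> of X is symmetric under \<open>i \<mapsto> 2 n - i\<close> for \<open>k \<le> n\<close> and antisymmetric for \<open>k > n\<close>: the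
  columns of X are an orthonormal eigenbasis of the reversal of coordinates, and \<open>e k\<close> is the eigenvalue.
  A point reflection of \<open>X P X\<close> therefore only changes signs in \<open>P\<close>.
\<close>

lemma rotated_X_conjugate:
  assumes P: "P \<in> carrier_mat (2 * n + 1) (2 * n + 1)"
  defines "e \<equiv> \<lambda>k. if k \<le> n then 1 else - 1"
  shows "mat (2 * n + 1) (2 * n + 1) (\<lambda>(i, j). (X_mat n * P * X_mat n) $$ (2 * n - i, 2 * n - j)) =
    X_mat n * mat (2 * n + 1) (2 * n + 1) (\<lambda>(k, l). e k * e l * P $$ (k, l)) * X_mat n"
    (is "_ = X_mat n * ?Q * X_mat n")
proof (rule eq_matI)
  have Q: "?Q \<in> carrier_mat (2 * n + 1) (2 * n + 1)" by simp
  fix i j assume "i < dim_row (X_mat n * ?Q * X_mat n)" "j < dim_col (X_mat n * ?Q * X_mat n)"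
  then have ij: "i < 2 * n + 1" "j < 2 * n + 1"
    using X_conjugate_carrier[OF Q] by auto
  then have ij': "2 * n - i < 2 * n + 1" "2 * n - j < 2 * n + 1" by auto
  have row: "X_mat n $$ (2 * n - i, k) = e k * X_mat n $$ (i, k)" if "k < 2 * n + 1" for k
    using that ij by (auto simp: X_mat_index e_def)
  have col: "X_mat n $$ (l, 2 * n - j) = e l * X_mat n $$ (l, j)" if "l < 2 * n + 1" for l
    using that ij by (auto simp: X_mat_index e_def)
  have "(X_mat n * P * X_mat n) $$ (2 * n - i, 2 * n - j) = (X_mat n * ?Q * X_mat n) $$ (i, j)"
    unfolding X_conjugate_index[OF P ij'] X_conjugate_index[OF Q ij]
    by (intro sum.cong refl) (simp add: row col)
  then show "mat (2 * n + 1) (2 * n + 1) (\<lambda>(i, j). (X_mat n * P * X_mat n) $$ (2 * n - i, 2 * n - j)) $$ (i, j)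
      = (X_mat n * ?Q * X_mat n) $$ (i, j)"
    using ij by simp
qed simp_all

text \<open>
  The point reflection fixes the entries of \<open>P\<close> at which both indices belong to the same eigenvalue and
  negates the others. It negates all of \<open>P\<close> only if the former vanish.
\<close>

lemma X_conjugate_skew_iff:
  assumes P: "P \<in> carrier_mat (2 * n + 1) (2 * n + 1)"
  defines "M \<equiv> X_mat n * P * X_mat n"
  shows "(\<forall>i<2 * n + 1. \<forall>j<2 * n + 1. M $$ (i, j) + M $$ (2 * n - i, 2 * n - j) = 0) \<longleftrightarrow>
    (\<forall>i<2 * n + 1. \<forall>j<2 * n + 1. (i \<le> n \<longleftrightarrow> j \<le> n) \<longrightarrow> P $$ (i, j) = 0)"
    (is "?skew \<longleftrightarrow> _")
proof -
  let ?m = "2 * n + 1"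
  define R where "R = mat ?m ?m (\<lambda>(i, j). M $$ (2 * n - i, 2 * n - j))"
  define Q where "Q = mat ?m ?m (\<lambda>(k, l). (if k \<le> n then 1 else - 1) * (if l \<le> n then 1 else - 1) * P $$ (k, l))"
  have M: "M \<in> carrier_mat ?m ?m" unfolding M_def using P by (rule X_conjugate_carrier)
  have neg: "- M = X_mat n * (- P) * X_mat n"
    unfolding M_def using P by (subst uminus_mult_right_mat) auto
  have RQ: "R = X_mat n * Q * X_mat n"
    unfolding R_def Q_def M_def using P by (rule rotated_X_conjugate)
  have "?skew \<longleftrightarrow> R = - M"
    using M by (auto simp: R_def mat_eq_iff eq_neg_iff_add_eq_0 add.commute)
  also have "\<dots> \<longleftrightarrow> Q = - P"
    unfolding neg RQ using P by (intro X_conjugate_eq_iff) (auto simp: Q_def)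
  also have "\<dots> \<longleftrightarrow> (\<forall>i<?m. \<forall>j<?m. (i \<le> n \<longleftrightarrow> j \<le> n) \<longrightarrow> P $$ (i, j) = 0)"
    using P by (auto simp: Q_def mat_eq_iff)
  finally show ?thesis .
qed

lemma X_conjugate_even_iff:
  assumes P: "P \<in> carrier_mat (2 * n + 1) (2 * n + 1)"
  defines "M \<equiv> X_mat n * P * X_mat n"
  shows "(\<forall>i<2 * n + 1. \<forall>j<2 * n + 1. M $$ (i, j) = M $$ (2 * n - i, 2 * n - j)) \<longleftrightarrow>
    (\<forall>i<2 * n + 1. \<forall>j<2 * n + 1. (i \<le> n \<longleftrightarrow> \<not> j \<le> n) \<longrightarrow> P $$ (i, j) = 0)"
    (is "?even \<longleftrightarrow> _")
proof -
  let ?m = "2 * n + 1"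
  define R where "R = mat ?m ?m (\<lambda>(i, j). M $$ (2 * n - i, 2 * n - j))"
  have R_dims: "dim_row R = ?m" "dim_col R = ?m" by (simp_all add: R_def)
  define Q where "Q = mat ?m ?m (\<lambda>(k, l). (if k \<le> n then 1 else - 1) * (if l \<le> n then 1 else - 1) * P $$ (k, l))"
  have M: "M \<in> carrier_mat ?m ?m" unfolding M_def using P by (rule X_conjugate_carrier)
  have RQ: "R = X_mat n * Q * X_mat n"
    unfolding R_def Q_def M_def using P by (rule rotated_X_conjugate)
  have "?even \<longleftrightarrow> (\<forall>i<?m. \<forall>j<?m. R $$ (i, j) = M $$ (i, j))"
    unfolding R_def by (simp add: eq_commute)
  also have "\<dots> \<longleftrightarrow> R = M"
    using M by (simp add: mat_eq_iff R_dims)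
  also have "\<dots> \<longleftrightarrow> Q = P"
    unfolding M_def RQ using P by (intro X_conjugate_eq_iff) (auto simp: Q_def)
  also have "\<dots> \<longleftrightarrow> (\<forall>i<?m. \<forall>j<?m. (i \<le> n \<longleftrightarrow> \<not> j \<le> n) \<longrightarrow> P $$ (i, j) = 0)"
    using P by (auto simp: Q_def mat_eq_iff)
  finally show ?thesis .
qed

section \<open>Line sums\<close>

lemma X_mat_times_ones:
  "X_mat n * one_col (2 * n + 1) =
    mat (2 * n + 1) 1 (\<lambda>(i, _). if i < n then sqrt 2 else if i = n then 1 else 0)"
proof (rule eq_matI)
  fix i j :: nat
  assume "i < dim_row (mat (2 * n + 1) 1 (\<lambda>(i, _). if i < n then sqrt 2 else if i = n then 1 else 0) :: real mat)"
    "j < dim_col (mat (2 * n + 1) 1 (\<lambda>(i, _). if i < n then sqrt 2 else if i = n then 1 else 0) :: real mat)"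
  then have ij: "i < 2 * n + 1" "j < 1" by auto
  have "(X_mat n * one_col (2 * n + 1)) $$ (i, j)
      = (\<Sum>k<2 * n + 1. X_mat n $$ (i, k) * one_col (2 * n + 1) $$ (k, j))"
    by (rule index_mult_sum[of _ "2 * n + 1" _ _ 1]) (use ij in \<open>auto simp: one_col_def\<close>)
  also have "\<dots> = (\<Sum>k<2 * n + 1. X_mat n $$ (i, k) * 1)"
    using ij by (intro sum.cong) (auto simp: one_col_def)
  also have "\<dots> = (if i < n then sqrt 2 else if i = n then 1 else 0)"
    unfolding X_mat_sum[OF ij(1)] by (simp add: real_div_sqrt)
  finally show "(X_mat n * one_col (2 * n + 1)) $$ (i, j)
    = mat (2 * n + 1) 1 (\<lambda>(i, _). if i < n then sqrt 2 else if i = n then 1 else 0) $$ (i, j)"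
    using ij by simp
qed (auto simp: one_col_def)

text \<open>
  The row sums of \<open>M = X P X\<close> form the vector \<open>M 1 = X (P (X 1))\<close>. As X is invertible, it vanishes
  exactly when \<open>P\<close> annihilates \<open>X 1\<close>, whose entries are \<open>sqrt 2\<close> (\<open>n\<close> times), then \<open>1\<close>, then \<open>0\<close>
  (\<open>n\<close> times). This is where the factors \<open>- sqrt 2\<close> in the middle row and column come from.
\<close>

lemma X_conjugate_row_sums_zero_iff:
  assumes P: "P \<in> carrier_mat (2 * n + 1) (2 * n + 1)"
  shows "(\<forall>i<2 * n + 1. (\<Sum>j<2 * n + 1. (X_mat n * P * X_mat n) $$ (i, j)) = 0) \<longleftrightarrow>
    (\<forall>i<2 * n + 1. P $$ (i, n) = - sqrt 2 * (\<Sum>j<n. P $$ (i, j)))"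
proof -
  let ?m = "2 * n + 1" and ?M = "X_mat n * P * X_mat n"
  let ?u = "X_mat n * one_col (2 * n + 1)"
  note X = X_mat_carrier[of n]
  have M: "?M \<in> carrier_mat ?m ?m" using P by (rule X_conjugate_carrier)
  have one: "one_col ?m \<in> carrier_mat ?m 1" by (simp add: one_col_def)
  have u: "?u \<in> carrier_mat ?m 1" using X one by (rule mult_carrier_mat)
  have Pu: "P * ?u \<in> carrier_mat ?m 1" using P u by (rule mult_carrier_mat)
  have pos: "(0::nat) < 1" by simp
  have "?M * one_col ?m = X_mat n * (P * ?u)"
    using P X one assoc_mult_mat[OF mult_carrier_mat[OF X P] X one] assoc_mult_mat[OF X P u] by simp
  moreover have "(?M * one_col ?m) $$ (i, 0) = (\<Sum>j<?m. ?M $$ (i, j))" if "i < ?m" for i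
    unfolding index_mult_sum[OF M one that pos]
    by (intro sum.cong) (auto simp: one_col_def)
  ultimately have "(\<forall>i<?m. (\<Sum>j<?m. ?M $$ (i, j)) = 0) \<longleftrightarrow> X_mat n * (P * ?u) = 0\<^sub>m ?m 1"
    using X by (auto simp: mat_eq_iff one_col_def simp del: index_mult_mat(1))
  also have "\<dots> \<longleftrightarrow> P * ?u = 0\<^sub>m ?m 1"
    using X_mat_cancel[OF Pu] X by (metis right_mult_zero_mat)
  also have "\<dots> \<longleftrightarrow> (\<forall>i<?m. (P * ?u) $$ (i, 0) = 0)"
    using Pu by (auto simp: mat_eq_iff simp del: index_mult_mat(1))
  also have "\<dots> \<longleftrightarrow> (\<forall>i<?m. P $$ (i, n) = - sqrt 2 * (\<Sum>j<n. P $$ (i, j)))"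
  proof -
    have "(P * ?u) $$ (i, 0) = sqrt 2 * (\<Sum>j<n. P $$ (i, j)) + P $$ (i, n)" if "i < ?m" for i
    proof -
      have "(P * ?u) $$ (i, 0) = (\<Sum>k<?m. P $$ (i, k) * ?u $$ (k, 0))"
        using P u that by (rule index_mult_sum) simp
      also have "\<dots> = (\<Sum>k<?m. P $$ (i, k) * (if k < n then sqrt 2 else if k = n then 1 else 0))"
        unfolding X_mat_times_ones by (intro sum.cong) auto
      also have "\<dots> = (\<Sum>k<Suc n. P $$ (i, k) * (if k < n then sqrt 2 else if k = n then 1 else 0))"
        by (intro sum.mono_neutral_right) auto
      also have "\<dots> = sqrt 2 * (\<Sum>j<n. P $$ (i, j)) + P $$ (i, n)"
        by (simp add: sum_distrib_left mult.commute)
      finally show ?thesis .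
    qed
    then show ?thesis by (auto simp: add_eq_0_iff2 simp del: index_mult_mat(1))
  qed
  finally show ?thesis .
qed

text \<open>
  Since X is symmetric, the transpose of \<open>X P X\<close> is the conjugate of the transpose of \<open>P\<close>, so the condition
  on the columns is the condition on the rows for the transposed matrix.
\<close>

lemma X_conjugate_semimagic_iff:
  assumes P: "P \<in> carrier_mat (2 * n + 1) (2 * n + 1)"
  shows "semimagic (2 * n + 1) 0 (X_mat n * P * X_mat n) \<longleftrightarrow>
    (\<forall>i<2 * n + 1. P $$ (i, n) = - sqrt 2 * (\<Sum>j<n. P $$ (i, j))) \<and>
    (\<forall>j<2 * n + 1. P $$ (n, j) = - sqrt 2 * (\<Sum>i<n. P $$ (i, j)))"
proof -
  let ?m = "2 * n + 1" and ?M = "X_mat n * P * X_mat n"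
  have M: "?M \<in> carrier_mat ?m ?m" using P by (rule X_conjugate_carrier)
  have P': "P\<^sup>T \<in> carrier_mat ?m ?m" using P by simp
  note X = X_mat_carrier[of n]
  have tr: "?M\<^sup>T = X_mat n * P\<^sup>T * X_mat n"
    using transpose_mult[OF mult_carrier_mat[OF X P] X] transpose_mult[OF X P]
      assoc_mult_mat[OF X P' X]
    by (simp add: X_mat_symmetric)
  have "(\<forall>j<?m. (\<Sum>i<?m. ?M $$ (i, j)) = 0) \<longleftrightarrow> (\<forall>j<?m. (\<Sum>i<?m. (?M\<^sup>T) $$ (j, i)) = 0)"
    using M by (intro all_cong arg_cong2[where f = "(=)"] sum.cong) auto
  also have "\<dots> \<longleftrightarrow> (\<forall>j<?m. P\<^sup>T $$ (j, n) = - sqrt 2 * (\<Sum>i<n. P\<^sup>T $$ (j, i)))"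
    unfolding tr by (rule X_conjugate_row_sums_zero_iff[OF P'])
  also have "\<dots> \<longleftrightarrow> (\<forall>j<?m. P $$ (n, j) = - sqrt 2 * (\<Sum>i<n. P $$ (i, j)))"
    using P by (intro all_cong arg_cong2[where f = "(=)"] arg_cong2[where f = "(*)"] sum.cong) auto
  finally show ?thesis
    using M X_conjugate_row_sums_zero_iff[OF P] by (simp add: semimagic_def)
qed

section \<open>Rational entries\<close>

lemma rational_entries_iff:
  assumes "M \<in> carrier_mat r s"
  shows "rational_entries M \<longleftrightarrow> (\<forall>i<r. \<forall>j<s. M $$ (i, j) \<in> \<rat>)"
proof -
  have "elements_mat M = {M $$ (i, j) |i j. i < r \<and> j < s}"
    using assms by (auto intro: elements_matI dest!: elements_matD)
  then show ?thesis by (auto simp: rational_entries_def)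
qed

text \<open>
  With \<open>S\<close> the diagonal matrix with entries \<open>s i\<close>, both \<open>X S^(-1)\<close> and \<open>S X\<close> have rational entries, because
  X never connects the middle index with another one. Hence \<open>M = (X S^(-1)) (S P S) (S^(-1) X)\<close> and
  \<open>S P S = (S X) M (X S)\<close> turn rational entries of \<open>S P S\<close> into rational entries of \<open>M\<close> and back.
\<close>

lemma X_conjugate_rational_iff:
  assumes P: "P \<in> carrier_mat (2 * n + 1) (2 * n + 1)"
  defines "s \<equiv> \<lambda>i. if i = n then 1 else 1 / sqrt 2"
  shows "rational_entries (X_mat n * P * X_mat n) \<longleftrightarrow>
    (\<forall>i<2 * n + 1. \<forall>j<2 * n + 1. s i * P $$ (i, j) * s j \<in> \<rat>)"
proof -
  let ?m = "2 * n + 1" and ?M = "X_mat n * P * X_mat n"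
  have M: "?M \<in> carrier_mat ?m ?m" using P by (rule X_conjugate_carrier)
  have s_nz: "s k \<noteq> 0" for k by (simp add: s_def)
  have quot: "X_mat n $$ (i, k) / s k \<in> \<rat>" "X_mat n $$ (k, i) / s k \<in> \<rat>"
    if "i < ?m" "k < ?m" for i k
    using that by (auto simp: X_mat_index s_def)
  have prod: "s i * X_mat n $$ (i, k) \<in> \<rat>" "X_mat n $$ (k, i) * s i \<in> \<rat>"
    if "i < ?m" "k < ?m" for i k
    using that by (auto simp: X_mat_index s_def)
  have "?M $$ (i, j) \<in> \<rat>"
    if Q: "\<forall>i<?m. \<forall>j<?m. s i * P $$ (i, j) * s j \<in> \<rat>" and ij: "i < ?m" "j < ?m" for i j
  proof -
    have "?M $$ (i, j) = (\<Sum>l<?m. \<Sum>k<?m.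
        (X_mat n $$ (i, k) / s k) * (s k * P $$ (k, l) * s l) * (X_mat n $$ (l, j) / s l))"
      unfolding X_conjugate_index[OF P ij] using s_nz by (intro sum.cong) auto
    also have "\<dots> \<in> \<rat>"
      by (intro Rats_sum, rule Rats_mult[OF Rats_mult]) (use Q quot ij in auto)
    finally show ?thesis .
  qed
  moreover have "s i * P $$ (i, j) * s j \<in> \<rat>"
    if R: "\<forall>i<?m. \<forall>j<?m. ?M $$ (i, j) \<in> \<rat>" and ij: "i < ?m" "j < ?m" for i j
  proof -
    have "s i * P $$ (i, j) * s j = s i * (X_mat n * ?M * X_mat n) $$ (i, j) * s j"
      using X_conjugate_twice[OF P] by simp
    also have "\<dots> = (\<Sum>l<?m. \<Sum>k<?m. (s i * X_mat n $$ (i, k)) * ?M $$ (k, l) * (X_mat n $$ (l, j) * s j))"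
      unfolding X_conjugate_index[OF M ij] sum_distrib_left sum_distrib_right
      by (intro sum.cong) (auto simp: mult_ac)
    also have "\<dots> \<in> \<rat>"
      by (intro Rats_sum, rule Rats_mult[OF Rats_mult]) (use R prod ij in auto)
    finally show ?thesis .
  qed
  ultimately show ?thesis unfolding rational_entries_iff[OF M] by blast
qed

section \<open>Entries of the block matrices\<close>

lemma times_one_col_index:
  assumes "A \<in> carrier_mat r n" "i < r"
  shows "(A * one_col n) $$ (i, 0) = (\<Sum>k<n. A $$ (i, k))"
proof -
  have "one_col n \<in> carrier_mat n 1" by (simp add: one_col_def)
  from index_mult_sum[OF assms(1) this assms(2), of 0]
  have "(A * one_col n) $$ (i, 0) = (\<Sum>k<n. A $$ (i, k) * one_col n $$ (k, 0))" by simp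
  also have "\<dots> = (\<Sum>k<n. A $$ (i, k))" by (intro sum.cong) (auto simp: one_col_def)
  finally show ?thesis .
qed

lemma A_block_parts:
  assumes V: "V \<in> carrier_mat n n" and W: "W \<in> carrier_mat n n"
  shows "0\<^sub>m n n \<in> carrier_mat n n" "zero_col n \<in> carrier_mat n 1" "V\<^sup>T \<in> carrier_mat n n"
      "(zero_col n)\<^sup>T \<in> carrier_mat 1 n" "0\<^sub>m 1 1 \<in> carrier_mat 1 1"
      "(- sqrt 2) \<cdot>\<^sub>m (V * one_col n)\<^sup>T \<in> carrier_mat 1 n"
      "W \<in> carrier_mat n n" "(- sqrt 2) \<cdot>\<^sub>m (W * one_col n) \<in> carrier_mat n 1"
      "0\<^sub>m n n \<in> carrier_mat n n"
proof -
  have one: "one_col n \<in> carrier_mat n 1" by (simp add: one_col_def)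
  have V1: "V * one_col n \<in> carrier_mat n 1" and W1: "W * one_col n \<in> carrier_mat n 1"
    using mult_carrier_mat[OF V one] mult_carrier_mat[OF W one] by auto
  show "0\<^sub>m n n \<in> carrier_mat n n" "zero_col n \<in> carrier_mat n 1" "V\<^sup>T \<in> carrier_mat n n"
      "(zero_col n)\<^sup>T \<in> carrier_mat 1 n" "0\<^sub>m 1 1 \<in> carrier_mat 1 1"
      "(- sqrt 2) \<cdot>\<^sub>m (V * one_col n)\<^sup>T \<in> carrier_mat 1 n"
      "W \<in> carrier_mat n n" "(- sqrt 2) \<cdot>\<^sub>m (W * one_col n) \<in> carrier_mat n 1"
      "0\<^sub>m n n \<in> carrier_mat n n"
    using V W V1 W1 by (simp_all del: index_mult_mat)
qed

lemma A_block_carrier: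
  assumes "V \<in> carrier_mat n n" "W \<in> carrier_mat n n"
  shows "A_block n V W \<in> carrier_mat (2 * n + 1) (2 * n + 1)"
  using blocks_carrier[OF A_block_parts[OF assms]] unfolding A_block_def .

lemma A_block_index:
  assumes V: "V \<in> carrier_mat n n" and W: "W \<in> carrier_mat n n"
    and ij: "i < 2 * n + 1" "j < 2 * n + 1"
  shows "A_block n V W $$ (i, j) =
    (if i \<le> n then
       if j \<le> n then 0
       else if i < n then V $$ (j - Suc n, i) else - sqrt 2 * (\<Sum>k<n. V $$ (j - Suc n, k))
     else
       if j < n then W $$ (i - Suc n, j)
       else if j = n then - sqrt 2 * (\<Sum>k<n. W $$ (i - Suc n, k)) else 0)"
proof -
  have one: "one_col n \<in> carrier_mat n 1" by (simp add: one_col_def)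
  have V1: "V * one_col n \<in> carrier_mat n 1" and W1: "W * one_col n \<in> carrier_mat n 1"
    using mult_carrier_mat[OF V one] mult_carrier_mat[OF W one] by auto
  note dims = carrier_matD[OF V] carrier_matD[OF W] carrier_matD[OF V1] carrier_matD[OF W1]
  show ?thesis
    unfolding blocks_index[OF A_block_parts[OF V W] ij, folded A_block_def] using ij
    by (cases i n rule: linorder_cases; cases j n rule: linorder_cases)
      (simp_all del: index_mult_mat
         add: dims times_one_col_index[OF V] times_one_col_index[OF W])
qed

lemma B_block_parts:
  assumes Y: "Y \<in> carrier_mat n n" and Z: "Z \<in> carrier_mat n n"
  shows "Y \<in> carrier_mat n n" "(- sqrt 2) \<cdot>\<^sub>m (Y * one_col n) \<in> carrier_mat n 1"
      "0\<^sub>m n n \<in> carrier_mat n n"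
      "(- sqrt 2) \<cdot>\<^sub>m (Y\<^sup>T * one_col n)\<^sup>T \<in> carrier_mat 1 n"
      "2 \<cdot>\<^sub>m ((one_col n)\<^sup>T * Y * one_col n) \<in> carrier_mat 1 1" "(zero_col n)\<^sup>T \<in> carrier_mat 1 n"
      "0\<^sub>m n n \<in> carrier_mat n n" "zero_col n \<in> carrier_mat n 1" "Z \<in> carrier_mat n n"
proof -
  have one: "one_col n \<in> carrier_mat n 1" by (simp add: one_col_def)
  have oneT: "(one_col n)\<^sup>T \<in> carrier_mat 1 n" by (simp add: one_col_def)
  have Y': "Y\<^sup>T \<in> carrier_mat n n" using Y by simp
  have oY: "(one_col n)\<^sup>T * Y \<in> carrier_mat 1 n" using oneT Y by (rule mult_carrier_mat)
  have Y1: "Y * one_col n \<in> carrier_mat n 1" and Y'1: "Y\<^sup>T * one_col n \<in> carrier_mat n 1"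
    and oY1: "(one_col n)\<^sup>T * Y * one_col n \<in> carrier_mat 1 1"
    using mult_carrier_mat[OF Y one] mult_carrier_mat[OF Y' one] mult_carrier_mat[OF oY one] by auto
  show "Y \<in> carrier_mat n n" "(- sqrt 2) \<cdot>\<^sub>m (Y * one_col n) \<in> carrier_mat n 1"
      "0\<^sub>m n n \<in> carrier_mat n n"
      "(- sqrt 2) \<cdot>\<^sub>m (Y\<^sup>T * one_col n)\<^sup>T \<in> carrier_mat 1 n"
      "2 \<cdot>\<^sub>m ((one_col n)\<^sup>T * Y * one_col n) \<in> carrier_mat 1 1" "(zero_col n)\<^sup>T \<in> carrier_mat 1 n"
      "0\<^sub>m n n \<in> carrier_mat n n" "zero_col n \<in> carrier_mat n 1" "Z \<in> carrier_mat n n"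
    using Y Z Y1 Y'1 oY1 by (simp_all del: index_mult_mat)
qed

lemma B_block_carrier:
  assumes "Y \<in> carrier_mat n n" "Z \<in> carrier_mat n n"
  shows "B_block n Y Z \<in> carrier_mat (2 * n + 1) (2 * n + 1)"
  using blocks_carrier[OF B_block_parts[OF assms]] unfolding B_block_def .

lemma B_block_index:
  assumes Y: "Y \<in> carrier_mat n n" and Z: "Z \<in> carrier_mat n n"
    and ij: "i < 2 * n + 1" "j < 2 * n + 1"
  shows "B_block n Y Z $$ (i, j) =
    (if i < n then
       if j < n then Y $$ (i, j) else if j = n then - sqrt 2 * (\<Sum>k<n. Y $$ (i, k)) else 0
     else if i = n then
       if j < n then - sqrt 2 * (\<Sum>k<n. Y $$ (k, j))
       else if j = n then 2 * (\<Sum>l<n. \<Sum>k<n. Y $$ (k, l)) else 0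
     else if j \<le> n then 0 else Z $$ (i - Suc n, j - Suc n))"
proof -
  have one: "one_col n \<in> carrier_mat n 1" by (simp add: one_col_def)
  have oneT: "(one_col n)\<^sup>T \<in> carrier_mat 1 n" by (simp add: one_col_def)
  have Y': "Y\<^sup>T \<in> carrier_mat n n" using Y by simp
  have oY: "(one_col n)\<^sup>T * Y \<in> carrier_mat 1 n" using oneT Y by (rule mult_carrier_mat)
  have Y1: "Y * one_col n \<in> carrier_mat n 1" and Y'1: "Y\<^sup>T * one_col n \<in> carrier_mat n 1"
    and oY1: "(one_col n)\<^sup>T * Y * one_col n \<in> carrier_mat 1 1"
    using mult_carrier_mat[OF Y one] mult_carrier_mat[OF Y' one] mult_carrier_mat[OF oY one] by auto
  note dims = carrier_matD[OF Y] carrier_matD[OF Z] carrier_matD[OF Y1] carrier_matD[OF Y'1]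
    carrier_matD[OF oY1]
  have pos: "(0::nat) < 1" by simp
  have "((one_col n)\<^sup>T * Y) $$ (0, l) = (\<Sum>k<n. Y $$ (k, l))" if "l < n" for l
    unfolding index_mult_sum[OF oneT Y pos that]
    by (intro sum.cong) (auto simp: one_col_def)
  then have centre: "((one_col n)\<^sup>T * Y * one_col n) $$ (0, 0) = (\<Sum>l<n. \<Sum>k<n. Y $$ (k, l))"
    unfolding times_one_col_index[OF oY pos] by (intro sum.cong) auto
  have colsum: "(Y\<^sup>T * one_col n) $$ (j, 0) = (\<Sum>k<n. Y $$ (k, j))" if "j < n" for j
    unfolding times_one_col_index[OF Y' that] by (intro sum.cong) (use Y that in auto)
  show ?thesis
    unfolding blocks_index[OF B_block_parts[OF Y Z] ij, folded B_block_def] using ij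
    by (cases i n rule: linorder_cases; cases j n rule: linorder_cases)
      (simp_all del: index_mult_mat add: dims times_one_col_index[OF Y] centre colsum)
qed

section \<open>Characterizing the block shapes\<close>

text \<open>
  Vanishing of the even positions leaves \<open>V\<close> and \<open>W\<close> as free blocks, and the line conditions determine
  the rest of the middle row and column from them.
\<close>

lemma A_block_iff:
  assumes P: "P \<in> carrier_mat (2 * n + 1) (2 * n + 1)"
  shows "(\<exists>V \<in> carrier_mat n n. \<exists>W \<in> carrier_mat n n. P = A_block n V W) \<longleftrightarrow>
    (\<forall>i<2 * n + 1. P $$ (i, n) = - sqrt 2 * (\<Sum>j<n. P $$ (i, j))) \<and>
    (\<forall>j<2 * n + 1. P $$ (n, j) = - sqrt 2 * (\<Sum>i<n. P $$ (i, j))) \<and>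
    (\<forall>i<2 * n + 1. \<forall>j<2 * n + 1. (i \<le> n \<longleftrightarrow> j \<le> n) \<longrightarrow> P $$ (i, j) = 0)"
    (is "?L \<longleftrightarrow> ?rows \<and> ?cols \<and> ?zero")
proof
  assume ?L
  then show "?rows \<and> ?cols \<and> ?zero" by (auto simp: A_block_index)
next
  assume R: "?rows \<and> ?cols \<and> ?zero"
  then have rows: "\<And>i. i < 2 * n + 1 \<Longrightarrow> P $$ (i, n) = - sqrt 2 * (\<Sum>j<n. P $$ (i, j))"
    and cols: "\<And>j. j < 2 * n + 1 \<Longrightarrow> P $$ (n, j) = - sqrt 2 * (\<Sum>i<n. P $$ (i, j))"
    and zero: "\<And>i j. i < 2 * n + 1 \<Longrightarrow> j < 2 * n + 1 \<Longrightarrow> (i \<le> n \<longleftrightarrow> j \<le> n) \<Longrightarrow> P $$ (i, j) = 0"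
    by blast+
  define V where "V = mat n n (\<lambda>(i, j). P $$ (j, Suc n + i))"
  define W where "W = mat n n (\<lambda>(i, j). P $$ (Suc n + i, j))"
  have VW: "V \<in> carrier_mat n n" "W \<in> carrier_mat n n" by (auto simp: V_def W_def)
  have "P = A_block n V W"
  proof (rule eq_matI)
    fix i j assume "i < dim_row (A_block n V W)" "j < dim_col (A_block n V W)"
    then have ij: "i < 2 * n + 1" "j < 2 * n + 1" using A_block_carrier[OF VW] by auto
    show "P $$ (i, j) = A_block n V W $$ (i, j)"
      unfolding A_block_index[OF VW ij] using rows[OF ij(1)] cols[OF ij(2)] zero[OF ij] ij
      by (cases i n rule: linorder_cases; cases j n rule: linorder_cases)
        (simp_all add: V_def W_def)
  qed (use P A_block_carrier[OF VW] in auto)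
  with VW show ?L by blast
qed

text \<open>
  Here the line conditions meet in the centre: applying the row condition and then the column condition
  gives \<open>(- sqrt 2) * (- sqrt 2) = 2\<close> times the sum of all entries of \<open>Y\<close>, and the other order gives
  the same value.
\<close>

lemma B_block_iff:
  assumes P: "P \<in> carrier_mat (2 * n + 1) (2 * n + 1)"
  shows "(\<exists>Y \<in> carrier_mat n n. \<exists>Z \<in> carrier_mat n n. P = B_block n Y Z) \<longleftrightarrow>
    (\<forall>i<2 * n + 1. P $$ (i, n) = - sqrt 2 * (\<Sum>j<n. P $$ (i, j))) \<and>
    (\<forall>j<2 * n + 1. P $$ (n, j) = - sqrt 2 * (\<Sum>i<n. P $$ (i, j))) \<and>
    (\<forall>i<2 * n + 1. \<forall>j<2 * n + 1. (i \<le> n \<longleftrightarrow> \<not> j \<le> n) \<longrightarrow> P $$ (i, j) = 0)"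
    (is "?L \<longleftrightarrow> ?rows \<and> ?cols \<and> ?zero")
proof
  assume ?L
  then obtain Y Z where YZ: "Y \<in> carrier_mat n n" "Z \<in> carrier_mat n n" and P: "P = B_block n Y Z"
    by blast
  have swap: "(\<Sum>l<n. \<Sum>k<n. Y $$ (l, k)) = (\<Sum>l<n. \<Sum>k<n. Y $$ (k, l))" by (rule sum.swap)
  show "?rows \<and> ?cols \<and> ?zero"
    unfolding P using YZ
    by (auto simp: B_block_index sum_distrib_left[symmetric] sum_negf swap simp flip: mult_minus_left)
next
  assume R: "?rows \<and> ?cols \<and> ?zero"
  then have rows: "\<And>i. i < 2 * n + 1 \<Longrightarrow> P $$ (i, n) = - sqrt 2 * (\<Sum>j<n. P $$ (i, j))"
    and cols: "\<And>j. j < 2 * n + 1 \<Longrightarrow> P $$ (n, j) = - sqrt 2 * (\<Sum>i<n. P $$ (i, j))"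
    and zero: "\<And>i j. i < 2 * n + 1 \<Longrightarrow> j < 2 * n + 1 \<Longrightarrow> (i \<le> n \<longleftrightarrow> \<not> j \<le> n) \<Longrightarrow> P $$ (i, j) = 0"
    by blast+
  define Y where "Y = mat n n (\<lambda>(i, j). P $$ (i, j))"
  define Z where "Z = mat n n (\<lambda>(i, j). P $$ (Suc n + i, Suc n + j))"
  have YZ: "Y \<in> carrier_mat n n" "Z \<in> carrier_mat n n" by (auto simp: Y_def Z_def)
  \<comment> \<open>the row condition in row \<open>n\<close>, then the column condition in each column \<open>l < n\<close>\<close>
  have "P $$ (n, n) = - sqrt 2 * (\<Sum>l<n. P $$ (n, l))" by (rule rows) simp
  also have "\<dots> = - sqrt 2 * (\<Sum>l<n. - sqrt 2 * (\<Sum>k<n. P $$ (k, l)))"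
    by (intro arg_cong2[where f = "(*)"] sum.cong refl cols) simp
  also have "\<dots> = 2 * (\<Sum>l<n. \<Sum>k<n. P $$ (k, l))"
    unfolding sum_distrib_left[symmetric] by simp
  finally have centre: "P $$ (n, n) = 2 * (\<Sum>l<n. \<Sum>k<n. P $$ (k, l))" .
  have "P = B_block n Y Z"
  proof (rule eq_matI)
    fix i j assume "i < dim_row (B_block n Y Z)" "j < dim_col (B_block n Y Z)"
    then have ij: "i < 2 * n + 1" "j < 2 * n + 1" using B_block_carrier[OF YZ] by auto
    show "P $$ (i, j) = B_block n Y Z $$ (i, j)"
      unfolding B_block_index[OF YZ ij] using rows[OF ij(1)] cols[OF ij(2)] zero[OF ij] ij centre
      by (cases i n rule: linorder_cases; cases j n rule: linorder_cases)
        (simp_all add: Y_def Z_def)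
  qed (use P B_block_carrier[OF YZ] in auto)
  with YZ show ?L by blast
qed

section \<open>Rationality of the blocks\<close>

lemma Rats_half:
  fixes x :: real
  assumes "x / 2 \<in> \<rat>"
  shows "x \<in> \<rat>"
  using Rats_mult[OF assms Rats_number_of[of "num.Bit0 num.One"]] by simp

text \<open>
  Scaling by \<open>s\<close> on both sides removes all irrational factors: the blocks become the halves of \<open>V\<^sup>T\<close> and \<open>W\<close>,
  and the middle row and column become sums of entries of \<open>V\<close> and \<open>W\<close>.
\<close>

lemma A_block_rational_iff:
  assumes V: "V \<in> carrier_mat n n" and W: "W \<in> carrier_mat n n"
  shows "rational_entries (X_mat n * A_block n V W * X_mat n) \<longleftrightarrow>
    rational_entries V \<and> rational_entries W"
proof -
  define s where "s i = (if i = n then 1 else 1 / sqrt 2)" for i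
  define Q where "Q i j = s i * A_block n V W $$ (i, j) * s j" for i j
  have Q: "Q i j =
    (if i \<le> n then
       if j \<le> n then 0
       else if i < n then V $$ (j - Suc n, i) / 2 else - (\<Sum>k<n. V $$ (j - Suc n, k))
     else
       if j < n then W $$ (i - Suc n, j) / 2
       else if j = n then - (\<Sum>k<n. W $$ (i - Suc n, k)) else 0)"
    if "i < 2 * n + 1" "j < 2 * n + 1" for i j
    using that by (auto simp: Q_def s_def A_block_index[OF V W])
  have "(\<forall>i<2 * n + 1. \<forall>j<2 * n + 1. Q i j \<in> \<rat>) \<longleftrightarrow> rational_entries V \<and> rational_entries W"
  proof
    assume R: "\<forall>i<2 * n + 1. \<forall>j<2 * n + 1. Q i j \<in> \<rat>"
    have "V $$ (i, j) \<in> \<rat>" if "i < n" "j < n" for i j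
    proof -
      have "Q j (Suc n + i) \<in> \<rat>" using R that by simp
      with that show ?thesis by (auto simp: Q dest: Rats_half)
    qed
    moreover have "W $$ (i, j) \<in> \<rat>" if "i < n" "j < n" for i j
    proof -
      have "Q (Suc n + i) j \<in> \<rat>" using R that by simp
      with that show ?thesis by (auto simp: Q dest: Rats_half)
    qed
    ultimately show "rational_entries V \<and> rational_entries W"
      using V W by (simp add: rational_entries_iff)
  next
    assume "rational_entries V \<and> rational_entries W"
    then show "\<forall>i<2 * n + 1. \<forall>j<2 * n + 1. Q i j \<in> \<rat>"
      using V W by (auto simp: Q rational_entries_iff intro!: Rats_sum)
  qed
  then show ?thesis
    unfolding X_conjugate_rational_iff[OF A_block_carrier[OF V W]] Q_def s_def .
qed

text \<open>
  The same scaling applies; the central entry is not scaled and is already a sum with the factor 2.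
\<close>

lemma B_block_rational_iff:
  assumes Y: "Y \<in> carrier_mat n n" and Z: "Z \<in> carrier_mat n n"
  shows "rational_entries (X_mat n * B_block n Y Z * X_mat n) \<longleftrightarrow>
    rational_entries Y \<and> rational_entries Z"
proof -
  define s where "s i = (if i = n then 1 else 1 / sqrt 2)" for i
  define Q where "Q i j = s i * B_block n Y Z $$ (i, j) * s j" for i j
  have Q: "Q i j =
    (if i < n then
       if j < n then Y $$ (i, j) / 2 else if j = n then - (\<Sum>k<n. Y $$ (i, k)) else 0
     else if i = n then
       if j < n then - (\<Sum>k<n. Y $$ (k, j))
       else if j = n then 2 * (\<Sum>l<n. \<Sum>k<n. Y $$ (k, l)) else 0
     else if j \<le> n then 0 else Z $$ (i - Suc n, j - Suc n) / 2)"
    if "i < 2 * n + 1" "j < 2 * n + 1" for i j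
    using that by (auto simp: Q_def s_def B_block_index[OF Y Z])
  have "(\<forall>i<2 * n + 1. \<forall>j<2 * n + 1. Q i j \<in> \<rat>) \<longleftrightarrow> rational_entries Y \<and> rational_entries Z"
  proof
    assume R: "\<forall>i<2 * n + 1. \<forall>j<2 * n + 1. Q i j \<in> \<rat>"
    have "Y $$ (i, j) \<in> \<rat>" if "i < n" "j < n" for i j
    proof -
      have "Q i j \<in> \<rat>" using R that by simp
      with that show ?thesis by (auto simp: Q dest: Rats_half)
    qed
    moreover have "Z $$ (i, j) \<in> \<rat>" if "i < n" "j < n" for i j
    proof -
      have "Q (Suc n + i) (Suc n + j) \<in> \<rat>" using R that by simp
      with that show ?thesis by (auto simp: Q dest: Rats_half)
    qed
    ultimately show "rational_entries Y \<and> rational_entries Z"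
      using Y Z by (simp add: rational_entries_iff)
  next
    assume "rational_entries Y \<and> rational_entries Z"
    then show "\<forall>i<2 * n + 1. \<forall>j<2 * n + 1. Q i j \<in> \<rat>"
      using Y Z by (auto simp: Q rational_entries_iff intro!: Rats_mult Rats_sum)
  qed
  then show ?thesis
    unfolding X_conjugate_rational_iff[OF B_block_carrier[OF Y Z]] Q_def s_def .
qed

section \<open>The matrix of ones\<close>

text \<open>
  With \<open>u = X 1\<close>, the block matrix is the outer product of \<open>u\<close> with itself, which is X conjugating the outer
  product of the vector of ones with itself.
\<close>

lemma E_block_conjugate: "X_mat n * E_block n * X_mat n = ones_mat (2 * n + 1)"
proof -
  let ?m = "2 * n + 1" and ?u = "X_mat n * one_col (2 * n + 1)"
  note X = X_mat_carrier[of n]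
  have one: "one_col ?m \<in> carrier_mat ?m 1" by (simp add: one_col_def)
  have oneT: "(one_col ?m)\<^sup>T \<in> carrier_mat 1 ?m" by (simp add: one_col_def)
  have c: "2 \<cdot>\<^sub>m ones_mat n \<in> carrier_mat n n" "sqrt 2 \<cdot>\<^sub>m one_col n \<in> carrier_mat n 1"
      "0\<^sub>m n n \<in> carrier_mat n n" "sqrt 2 \<cdot>\<^sub>m (one_col n)\<^sup>T \<in> carrier_mat 1 n"
      "1\<^sub>m 1 \<in> carrier_mat 1 1" "(zero_col n)\<^sup>T \<in> carrier_mat 1 n" "0\<^sub>m n n \<in> carrier_mat n n"
      "zero_col n \<in> carrier_mat n 1" "0\<^sub>m n n \<in> carrier_mat n n"
    by (simp_all add: one_col_def ones_mat_def)
  have E: "E_block n \<in> carrier_mat ?m ?m"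
    using blocks_carrier[OF c] unfolding E_block_def .
  have ones: "ones_mat ?m = one_col ?m * (one_col ?m)\<^sup>T"
    by (intro eq_matI) (auto simp: ones_mat_def one_col_def scalar_prod_def)
  have "E_block n = ?u * ?u\<^sup>T"
  proof (rule eq_matI)
    fix i j assume "i < dim_row (?u * ?u\<^sup>T)" "j < dim_col (?u * ?u\<^sup>T)"
    then have ij: "i < ?m" "j < ?m" by auto
    have outer: "(?u * ?u\<^sup>T) $$ (i, j) =
        (if i < n then sqrt 2 else if i = n then 1 else 0) * (if j < n then sqrt 2 else if j = n then 1 else 0)"
      unfolding X_mat_times_ones using ij by (simp add: scalar_prod_def)
    show "E_block n $$ (i, j) = (?u * ?u\<^sup>T) $$ (i, j)"
      unfolding outer blocks_index[OF c ij, folded E_block_def] using ij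
      by (cases i n rule: linorder_cases; cases j n rule: linorder_cases)
        (simp_all add: one_col_def ones_mat_def)
  qed (use E in auto)
  also have "?u\<^sup>T = (one_col ?m)\<^sup>T * X_mat n"
    using transpose_mult[OF X one] by (simp add: X_mat_symmetric)
  also have "?u * ((one_col ?m)\<^sup>T * X_mat n) = X_mat n * ones_mat ?m * X_mat n"
    unfolding ones
    using assoc_mult_mat[OF mult_carrier_mat[OF X one] oneT X] assoc_mult_mat[OF X one oneT] by simp
  finally have "X_mat n * E_block n * X_mat n = X_mat n * (X_mat n * ones_mat ?m * X_mat n) * X_mat n"
    by simp
  also have "\<dots> = ones_mat ?m" by (rule X_conjugate_twice) (simp add: ones_mat_def)
  finally show ?thesis .
qed

section \<open>The block representation of associated and balanced squares\<close>

theorem theorem2: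
  fixes n :: nat and M :: "real mat"
  assumes "M \<in> carrier_mat (2 * n + 1) (2 * n + 1)"
  shows
    "((M \<in> A0 (2 * n + 1) \<longleftrightarrow>
        (\<exists>V \<in> carrier_mat n n. \<exists>W \<in> carrier_mat n n. M = X_mat n * A_block n V W * X_mat n)) \<and>
      (\<forall>V \<in> carrier_mat n n. \<forall>W \<in> carrier_mat n n. M = X_mat n * A_block n V W * X_mat n \<longrightarrow>
        (rational_entries M \<longleftrightarrow> rational_entries V \<and> rational_entries W))) \<and>
     ((M \<in> B0 (2 * n + 1) \<longleftrightarrow>
        (\<exists>Y \<in> carrier_mat n n. \<exists>Z \<in> carrier_mat n n. M = X_mat n * B_block n Y Z * X_mat n)) \<and>
      (\<forall>Y \<in> carrier_mat n n. \<forall>Z \<in> carrier_mat n n. M = X_mat n * B_block n Y Z * X_mat n \<longrightarrow>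
        (rational_entries M \<longleftrightarrow> rational_entries Y \<and> rational_entries Z))) \<and>
     ones_mat (2 * n + 1) = X_mat n * E_block n * X_mat n"
proof -
  define P where "P = X_mat n * M * X_mat n"
  have P: "P \<in> carrier_mat (2 * n + 1) (2 * n + 1)"
    unfolding P_def using assms by (rule X_conjugate_carrier)
  have M: "M = X_mat n * P * X_mat n"
    unfolding P_def using X_conjugate_twice[OF assms] by simp
  have conj: "M = X_mat n * Q * X_mat n \<longleftrightarrow> P = Q"
    if "Q \<in> carrier_mat (2 * n + 1) (2 * n + 1)" for Q
    unfolding M using P that by (rule X_conjugate_eq_iff)
  have "M \<in> A0 (2 * n + 1) \<longleftrightarrow>
      (\<exists>V \<in> carrier_mat n n. \<exists>W \<in> carrier_mat n n. P = A_block n V W)"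
    unfolding A_block_iff[OF P] A0_def associated_def M mem_Collect_eq
      X_conjugate_semimagic_iff[OF P] X_conjugate_skew_iff[OF P, symmetric] by simp
  then have a: "M \<in> A0 (2 * n + 1) \<longleftrightarrow>
      (\<exists>V \<in> carrier_mat n n. \<exists>W \<in> carrier_mat n n. M = X_mat n * A_block n V W * X_mat n)"
    using conj[OF A_block_carrier] by blast
  have "M \<in> B0 (2 * n + 1) \<longleftrightarrow>
      (\<exists>Y \<in> carrier_mat n n. \<exists>Z \<in> carrier_mat n n. P = B_block n Y Z)"
    unfolding B_block_iff[OF P] B0_def balanced_def M mem_Collect_eq
      X_conjugate_semimagic_iff[OF P] X_conjugate_even_iff[OF P, symmetric] by simp
  then have b: "M \<in> B0 (2 * n + 1) \<longleftrightarrow>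
      (\<exists>Y \<in> carrier_mat n n. \<exists>Z \<in> carrier_mat n n. M = X_mat n * B_block n Y Z * X_mat n)"
    using conj[OF B_block_carrier] by blast
  show ?thesis
    by (intro conjI ballI impI;
      (rule a | rule b | rule E_block_conjugate[symmetric]
       | simp only: A_block_rational_iff B_block_rational_iff))
qed

end
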